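(* For every integer $N\ge1$, every map $f\colon\{\pm1\}^N\to\mathbb{R}$ and each $x\in\{\pm1\}^N$, $$\Big|\widehat f(\emptyset)+\frac12\sum_{S\ne\emptyset}\widehat f(S)\,x^S\Big|+\Big|\frac12\sum_{S\neq\emptyset}\widehat f(S)\,x^S\Big|\le\|f\|_\infty,$$ where the sums are over nonempty subsets $S\subset[N]$.
   Context: Here $[N]=\{1,\dots,N\}$, and for $f\colon\{\pm1\}^N\to\mathbb{R}$ and $S\subset[N]$ the Fourier coefficient is $\widehat f(S)=2^{-N}\sum_{x\in\{\pm1\}^N}f(x)\,x^S$, with $x^S=\prod_{k\in S}x_k$ and $x^\emptyset=1$, so that $f(x)=\sum_{S\subset[N]}\widehat f(S)x^S$. Also $\|f\|_\infty=\max_{x\in\{\pm1\}^N}|f(x)|$. *)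

theory Defs
  imports Complex_Main "HOL-Library.FuncSet"
begin

(* Points are extensional functions on {1..N}, so that each sign vector is represented
   exactly once and the cube has 2 ^ N elements. *)
definition cube :: "nat \<Rightarrow> (nat \<Rightarrow> real) set" where
  "cube N = {1..N} \<rightarrow>\<^sub>E {-1, 1}"

definition monomial :: "nat set \<Rightarrow> (nat \<Rightarrow> real) \<Rightarrow> real" where
  "monomial S x = (\<Prod>k\<in>S. x k)"

definition fourier_coeff :: "nat \<Rightarrow> ((nat \<Rightarrow> real) \<Rightarrow> real) \<Rightarrow> nat set \<Rightarrow> real" where
  "fourier_coeff N f S = (1 / 2 ^ N) * (\<Sum>x\<in>cube N. f x * monomial S x)"

definition sup_norm :: "nat \<Rightarrow> ((nat \<Rightarrow> real) \<Rightarrow> real) \<Rightarrow> real" where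
  "sup_norm N f = Max ((\<lambda>x. \<bar>f x\<bar>) ` cube N)"

end

theory Submission
  imports Defs
begin

text \<open>
  For reals \<open>a\<close> and \<open>b\<close>, \<open>\<bar>a\<bar> + \<bar>b\<bar>\<close> is the maximum of \<open>\<bar>a + b\<bar>\<close> and \<open>\<bar>a - b\<bar>\<close>. Let \<open>b\<close> be
  half of the nonconstant part of the Fourier expansion at \<open>x\<close>, and let \<open>a\<close> be the mean of \<open>f\<close> plus
  \<open>b\<close>. Then \<open>a - b\<close> is the mean of \<open>f\<close>, while \<open>a + b\<close> is the whole expansion, which equals \<open>f x\<close> by
  Fourier inversion. Neither a value nor the mean of \<open>f\<close> can exceed the sup norm in absolute value.

  Inversion comes from the reproducing kernel
  \<open>\<Sum>S. y\<^sup>S * x\<^sup>S = (\<Prod>k. 1 + y\<^sub>k * x\<^sub>k)\<close>: a factor vanishes as soon as \<open>y\<close> and \<open>x\<close> differ in some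
  coordinate, so only \<open>y = x\<close> survives when it is integrated against \<open>f\<close>.
\<close>

lemma finite_cube: "finite (cube N)"
  unfolding cube_def by (intro finite_PiE) auto

lemma card_cube: "card (cube N) = 2 ^ N"
proof -
  have "card {-1, 1 :: real} = 2"
    by simp
  then show ?thesis
    unfolding cube_def
    by (simp only: card_PiE finite_atLeastAtMost prod_constant card_atLeastAtMost) simp
qed

lemma cube_coordinate: "x \<in> cube N \<Longrightarrow> k \<in> {1..N} \<Longrightarrow> x k = -1 \<or> x k = 1"
  unfolding cube_def by (drule (1) PiE_mem) simp

lemma abs_le_sup_norm: "x \<in> cube N \<Longrightarrow> \<bar>f x\<bar> \<le> sup_norm N f"
  unfolding sup_norm_def by (intro Max_ge finite_imageI finite_cube imageI)

text \<open>
  The set runs over all subsets while the points are fixed, so the sum is an expanded product over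
  the coordinates, each of which contributes \<open>2\<close> where the points agree and \<open>0\<close> where they do not.
\<close>

lemma sum_monomials_orthogonal:
  assumes x: "x \<in> cube N" and y: "y \<in> cube N"
  shows "(\<Sum>S\<in>Pow {1..N}. monomial S y * monomial S x) = (if y = x then 2 ^ N else 0)"
proof -
  have "(\<Sum>S\<in>Pow {1..N}. monomial S y * monomial S x) = (\<Prod>k\<in>{1..N}. y k * x k + 1)"
    by (simp add: prod_add monomial_def prod.distrib)
  also have "\<dots> = (if y = x then 2 ^ N else 0)"
  proof (cases "y = x")
    case True
    have "(\<Prod>k\<in>{1..N}. y k * x k + 1) = (\<Prod>k\<in>{1..N}. (2::real))"
    proof (intro prod.cong refl)
      fix k assume "k \<in> {1..N}"
      from cube_coordinate[OF x this] True show "y k * x k + 1 = 2"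
        by (elim disjE) simp_all
    qed
    then show ?thesis
      using True by simp
  next
    case False
    then obtain k where k: "k \<in> {1..N}" "y k \<noteq> x k"
      using x y unfolding cube_def by (metis PiE_ext)
    then have "y k * x k + 1 = 0"
      using cube_coordinate[OF x k(1)] cube_coordinate[OF y k(1)] by auto
    then show ?thesis
      using False k(1) by (auto intro!: prod_zero)
  qed
  finally show ?thesis .
qed

lemma fourier_inversion:
  assumes x: "x \<in> cube N"
  shows "(\<Sum>S\<in>Pow {1..N}. fourier_coeff N f S * monomial S x) = f x"
proof -
  have "(\<Sum>S\<in>Pow {1..N}. fourier_coeff N f S * monomial S x)
      = (\<Sum>S\<in>Pow {1..N}. \<Sum>y\<in>cube N. f y / 2 ^ N * (monomial S y * monomial S x))"
    unfolding fourier_coeff_def sum_distrib_left sum_distrib_right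
    by (simp only: times_divide_eq_left mult_1_left mult.assoc)
  also have "\<dots> = (\<Sum>y\<in>cube N. f y / 2 ^ N * (\<Sum>S\<in>Pow {1..N}. monomial S y * monomial S x))"
    unfolding sum_distrib_left by (rule sum.swap)
  also have "\<dots> = (\<Sum>y\<in>cube N. if y = x then f y else 0)"
  proof (intro sum.cong refl)
    fix y assume y: "y \<in> cube N"
    show "f y / 2 ^ N * (\<Sum>S\<in>Pow {1..N}. monomial S y * monomial S x)
        = (if y = x then f y else 0)"
      unfolding sum_monomials_orthogonal[OF x y] by simp
  qed
  also have "\<dots> = f x"
    using x by (simp add: finite_cube)
  finally show ?thesis .
qed

lemma abs_mean_le_sup_norm: "\<bar>fourier_coeff N f {}\<bar> \<le> sup_norm N f"
proof -
  have "\<bar>\<Sum>y\<in>cube N. f y\<bar> \<le> (\<Sum>y\<in>cube N. \<bar>f y\<bar>)"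
    by (rule sum_abs)
  also have "\<dots> \<le> of_nat (card (cube N)) * sup_norm N f"
    by (intro sum_bounded_above abs_le_sup_norm)
  finally show ?thesis
    by (simp add: fourier_coeff_def monomial_def card_cube abs_mult field_simps)
qed

theorem theorem4p2:
  fixes N :: nat and f :: "(nat \<Rightarrow> real) \<Rightarrow> real" and x :: "nat \<Rightarrow> real"
  assumes "N \<ge> 1" and "x \<in> cube N"
  shows "\<bar>fourier_coeff N f {} + (1 / 2) * (\<Sum>S\<in>Pow {1..N} - {{}}. fourier_coeff N f S * monomial S x)\<bar>
       + \<bar>(1 / 2) * (\<Sum>S\<in>Pow {1..N} - {{}}. fourier_coeff N f S * monomial S x)\<bar> \<le> sup_norm N f"
proof -
  define s where "s = (\<Sum>S\<in>Pow {1..N} - {{}}. fourier_coeff N f S * monomial S x)"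
  have "f x = fourier_coeff N f {} * monomial {} x + s"
    unfolding s_def fourier_inversion[OF assms(2), of f, symmetric]
    by (intro sum.remove) auto
  then have "f x = fourier_coeff N f {} + s"
    by (simp add: monomial_def)
  \<comment> \<open>The left side is the maximum of \<open>\<bar>f x\<bar>\<close> and \<open>\<bar>fourier_coeff N f {}\<bar>\<close>.\<close>
  then have "\<bar>fourier_coeff N f {} + (1 / 2) * s\<bar> + \<bar>(1 / 2) * s\<bar> \<le> sup_norm N f"
    using abs_le_sup_norm[OF assms(2), of f] abs_mean_le_sup_norm[of N f] by linarith
  then show ?thesis
    unfolding s_def .
qed

end
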